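(* A ceer $E$ is light if and only if there is a non-trivial quotient $R$ of $E$ which is universal.
   Context: A ceer is a computably enumerable equivalence relation on $\omega$. For equivalence relations $E,R$ on $\omega$, $E\leq R$ means there is a computable $f$ with $x\mathrel{E}y\iff f(x)\mathrel{R}f(y)$ for all $x,y$. A ceer is universal if every ceer is $\leq$ it. $\mathrm{Id}$ is equality on $\omega$; a ceer $E$ is light if $\mathrm{Id}\leq E$. For a ceer $E$ and a c.e. set $W\subseteq\omega^2$, $E_{/W}$ denotes the equivalence relation generated by $E\cup W$; such ceers are called quotients of $E$, and a quotient $R$ of $E$ is non-trivial if $R\neq E$. *)

theory Defs
  imports Complex_Main "HOL-Library.Nat_Bijection"
begin

fun primrec_at :: "(nat \<rightharpoonup> nat) \<Rightarrow> (nat \<rightharpoonup> nat) \<Rightarrow> nat \<Rightarrow> nat \<Rightarrow> nat option" where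
  "primrec_at f g a 0 = f a"
| "primrec_at f g a (Suc n) =
     Option.bind (primrec_at f g a n) (\<lambda>r. g (prod_encode (a, prod_encode (n, r))))"

(* The search for a zero diverges as soon as it meets an undefined value. *)
definition minimize :: "(nat \<rightharpoonup> nat) \<Rightarrow> (nat \<rightharpoonup> nat)" where
  "minimize f x =
     (if \<exists>n. f (prod_encode (x, n)) = Some 0 \<and> (\<forall>m<n. f (prod_encode (x, m)) \<noteq> None)
      then Some (LEAST n. f (prod_encode (x, n)) = Some 0)
      else None)"

(* The unary partial recursive functions. Functions of several arguments are treated as
   unary ones through the Cantor pairing prod_encode, so the two projections and pairing
   take the place of the n-ary projections and n-ary composition; the identity is
   obtained by pairing the projections. *)
inductive partial_recursive :: "(nat \<rightharpoonup> nat) \<Rightarrow> bool" where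
  zero: "partial_recursive (\<lambda>x. Some 0)"
| succ: "partial_recursive (\<lambda>x. Some (Suc x))"
| proj1: "partial_recursive (\<lambda>x. Some (fst (prod_decode x)))"
| proj2: "partial_recursive (\<lambda>x. Some (snd (prod_decode x)))"
| pair: "\<lbrakk>partial_recursive f; partial_recursive g\<rbrakk> \<Longrightarrow>
    partial_recursive
      (\<lambda>x. Option.bind (f x) (\<lambda>u. Option.bind (g x) (\<lambda>v. Some (prod_encode (u, v)))))"
| comp: "\<lbrakk>partial_recursive f; partial_recursive g\<rbrakk> \<Longrightarrow>
    partial_recursive (\<lambda>x. Option.bind (f x) g)"
| prim: "\<lbrakk>partial_recursive f; partial_recursive g\<rbrakk> \<Longrightarrow>
    partial_recursive
      (\<lambda>x. primrec_at f g (fst (prod_decode x)) (snd (prod_decode x)))"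
| min: "partial_recursive f \<Longrightarrow> partial_recursive (minimize f)"

definition computable :: "(nat \<Rightarrow> nat) \<Rightarrow> bool" where
  "computable f \<longleftrightarrow> partial_recursive (\<lambda>x. Some (f x))"

definition ce_set :: "nat set \<Rightarrow> bool" where
  "ce_set A \<longleftrightarrow> (\<exists>f. partial_recursive f \<and> A = dom f)"

definition ce_rel :: "nat rel \<Rightarrow> bool" where
  "ce_rel W \<longleftrightarrow> ce_set (prod_encode ` W)"

definition ceer :: "nat rel \<Rightarrow> bool" where
  "ceer E \<longleftrightarrow> equiv UNIV E \<and> ce_rel E"

definition reducible :: "nat rel \<Rightarrow> nat rel \<Rightarrow> bool" where
  "reducible E R \<longleftrightarrow>
     (\<exists>f. computable f \<and> (\<forall>x y. (x, y) \<in> E \<longleftrightarrow> (f x, f y) \<in> R))"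

definition universal_ceer :: "nat rel \<Rightarrow> bool" where
  "universal_ceer R \<longleftrightarrow> ceer R \<and> (\<forall>E. ceer E \<longrightarrow> reducible E R)"

definition light :: "nat rel \<Rightarrow> bool" where
  "light E \<longleftrightarrow> ceer E \<and> reducible Id E"

definition quotient_by :: "nat rel \<Rightarrow> nat rel \<Rightarrow> nat rel" where
  "quotient_by E W = equiv UNIV hull (E \<union> W)"

definition is_quotient_of :: "nat rel \<Rightarrow> nat rel \<Rightarrow> bool" where
  "is_quotient_of R E \<longleftrightarrow> (\<exists>W. ce_rel W \<and> R = quotient_by E W)"

end

theory Submission
  imports Defs
begin

text \<open>
  If \<open>R\<close> is a universal quotient of \<open>E\<close>, then a reduction of \<open>Id\<close> to \<open>R\<close> is already a reduction
  to \<open>E\<close>, because \<open>E \<subseteq> R\<close>. Conversely, if \<open>f\<close> reduces \<open>Id\<close> to \<open>E\<close>, copy a universal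
  ceer \<open>U\<close> onto the \<open>E\<close>-classes of the values of \<open>f\<close>: since these classes are distinct, the
  quotient of \<open>E\<close> by the image of \<open>U\<close> restricts to \<open>U\<close> along \<open>f\<close>.

  Both the universal c.e. set behind \<open>U\<close> and the enumerability of generated equivalence relations
  come from one principle: what is derivable from an axiom by decidable rules with two
  premises is c.e. It is applied to the evaluation relation of coded programs and to the rules
  of equivalence relations.
\<close>

section \<open>Computable functions and decidable predicates\<close>

abbreviation pair_code :: "nat \<Rightarrow> nat \<Rightarrow> nat" (\<open>\<langle>_,/ _\<rangle>\<close>) where
  "\<langle>a, b\<rangle> \<equiv> prod_encode (a, b)"

abbreviation pfst :: "nat \<Rightarrow> nat" where
  "pfst x \<equiv> fst (prod_decode x)"

abbreviation psnd :: "nat \<Rightarrow> nat" where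
  "psnd x \<equiv> snd (prod_decode x)"

lemma pair_code_collapse: "\<langle>pfst x, psnd x\<rangle> = x"
  by simp

lemma pfst_le: "pfst x \<le> x" and psnd_le: "psnd x \<le> x"
  by (metis pair_code_collapse le_prod_encode_1) (metis pair_code_collapse le_prod_encode_2)

named_theorems computable_intros

lemma computable_id [computable_intros]: "computable (\<lambda>x. x)"
  using partial_recursive.pair[OF partial_recursive.proj1 partial_recursive.proj2]
  by (simp add: computable_def)

lemma computable_comp:
  assumes "computable f" "computable g"
  shows "computable (\<lambda>x. f (g x))"
  using partial_recursive.comp[of "\<lambda>x. Some (g x)" "\<lambda>x. Some (f x)"] assms
  by (simp add: computable_def)

lemma computable_Suc [computable_intros]: "computable f \<Longrightarrow> computable (\<lambda>x. Suc (f x))"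
  and computable_pfst [computable_intros]: "computable f \<Longrightarrow> computable (\<lambda>x. pfst (f x))"
  and computable_psnd [computable_intros]: "computable f \<Longrightarrow> computable (\<lambda>x. psnd (f x))"
  using computable_comp partial_recursive.succ partial_recursive.proj1 partial_recursive.proj2
  by (simp_all add: computable_def)

lemma computable_const [computable_intros]: "computable (\<lambda>x. c)"
proof (induction c)
  case 0
  show ?case
    using partial_recursive.zero by (simp add: computable_def)
qed (rule computable_Suc)

lemma computable_pair_code [computable_intros]:
  "computable f \<Longrightarrow> computable g \<Longrightarrow> computable (\<lambda>x. \<langle>f x, g x\<rangle>)"
  using partial_recursive.pair[of "\<lambda>x. Some (f x)" "\<lambda>x. Some (g x)"]
  by (simp add: computable_def)

text \<open>With total arguments \<open>primrec_at\<close> never fails and agrees with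
  \<open>rec_nat\<close>. The other total functions are built from this form of primitive
  recursion.\<close>

lemma computable_rec_nat:
  assumes "computable f" "computable k"
    and g: "computable (\<lambda>z. g (pfst z) (pfst (psnd z)) (psnd (psnd z)))"
  shows "computable (\<lambda>x. rec_nat (f x) (g x) (k x))"
proof -
  let ?g = "\<lambda>z. g (pfst z) (pfst (psnd z)) (psnd (psnd z))"
  have rec: "primrec_at (\<lambda>x. Some (f x)) (\<lambda>z. Some (?g z)) a n = Some (rec_nat (f a) (g a) n)"
    for a n
    by (induction n) simp_all
  have "computable (\<lambda>z. rec_nat (f (pfst z)) (g (pfst z)) (psnd z))"
    using partial_recursive.prim[of "\<lambda>x. Some (f x)" "\<lambda>z. Some (?g z)"] assms
    by (simp add: computable_def rec)
  from computable_comp[OF this computable_pair_code[OF computable_id assms(2)]] show ?thesis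
    by simp
qed

lemma computable_diff [computable_intros]:
  assumes "computable f" "computable g"
  shows "computable (\<lambda>x. f x - g x)"
proof -
  \<comment> \<open>The predecessor is the recursion that returns its counter; truncated subtraction
    iterates it.\<close>
  have pred: "rec_nat 0 (\<lambda>k _. k) n = n - 1" for n :: nat
    by (cases n) simp_all
  have minus: "rec_nat m (\<lambda>_ r. r - 1) n = m - n" for m n :: nat
    by (induction n) simp_all
  have "computable (\<lambda>x. x - 1)"
    using computable_rec_nat[of "\<lambda>_. 0" "\<lambda>x. x" "\<lambda>_ k _. k"]
    by (simp add: pred computable_intros)
  then have "computable (\<lambda>z. psnd (psnd z) - 1)"
    by (rule computable_comp) (intro computable_intros)
  from computable_rec_nat[OF assms this] show ?thesis
    by (simp only: minus)
qed

definition decidable :: "(nat \<Rightarrow> bool) \<Rightarrow> bool" where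
  "decidable P \<longleftrightarrow> computable (\<lambda>x. of_bool (P x))"

lemma computable_if [computable_intros]:
  assumes "decidable P" "computable f" "computable g"
  shows "computable (\<lambda>x. if P x then f x else g x)"
proof -
  \<comment> \<open>A recursion with constant step, run for zero or one rounds, selects the
    branch.\<close>
  have "rec_nat b (\<lambda>_ _. a) (of_bool P) = (if P then a else b)" for P and a b :: nat
    by simp
  moreover have "computable (\<lambda>z. f (pfst z))"
    by (intro computable_comp[OF assms(2)] computable_intros)
  ultimately show ?thesis
    using computable_rec_nat[of g "\<lambda>x. of_bool (P x)" "\<lambda>x _ _. f x"] assms
    by (simp add: decidable_def)
qed

lemma decidable_comp: "decidable P \<Longrightarrow> computable f \<Longrightarrow> decidable (\<lambda>x. P (f x))"
  unfolding decidable_def by (rule computable_comp)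

lemma decidable_not [computable_intros]: "decidable P \<Longrightarrow> decidable (\<lambda>x. \<not> P x)"
proof -
  have "of_bool (\<not> P x) = (1 - of_bool (P x) :: nat)" for x
    by simp
  then show "decidable P \<Longrightarrow> ?thesis"
    unfolding decidable_def by (simp only:) (intro computable_intros)
qed

lemma decidable_conj [computable_intros]:
  assumes "decidable P" "decidable Q"
  shows "decidable (\<lambda>x. P x \<and> Q x)"
proof -
  have "(\<lambda>x. of_bool (P x \<and> Q x)) = (\<lambda>x. if P x then of_bool (Q x) else (0 :: nat))"
    by auto
  then show ?thesis
    using computable_if[OF assms(1) _ computable_const] assms(2)
    by (simp add: decidable_def)
qed

lemma decidable_disj [computable_intros]:
  assumes "decidable P" "decidable Q"
  shows "decidable (\<lambda>x. P x \<or> Q x)"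
  using decidable_not[OF decidable_conj[OF assms[THEN decidable_not]]] by simp

lemma decidable_eq [computable_intros]:
  assumes "computable f" "computable g"
  shows "decidable (\<lambda>x. f x = g x)"
proof -
  \<comment> \<open>Subtraction is truncated, so both differences vanish exactly in the case of
    equality.\<close>
  have "of_bool (f x = g x) = 1 - (f x - g x) - (g x - f x)" for x
    by auto
  then show ?thesis
    unfolding decidable_def
    by (simp only:) (intro computable_intros assms)
qed

section \<open>Derivability by decidable rules\<close>

text \<open>The index \<open>Suc n\<close> is read as a node whose label and two children are packed
  in \<open>n\<close>. The children are at most \<open>n\<close>, so the shift by \<open>Suc\<close>
  makes both calls decrease.\<close>

function course :: "(nat \<Rightarrow> nat) \<Rightarrow> nat \<Rightarrow> nat \<Rightarrow> nat" where
  "course F c 0 = c"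
| "course F c (Suc n) = F \<langle>n, \<langle>course F c (pfst (psnd n)), course F c (psnd (psnd n))\<rangle>\<rangle>"
  by pat_completeness auto
termination
  by (relation "measure (\<lambda>(F, c, n). n)")
    (auto simp: less_Suc_eq_le intro: order_trans[OF pfst_le psnd_le] order_trans[OF psnd_le psnd_le])

text \<open>Primitive recursion suffices once it carries all earlier values as a nested pair;
  iterating \<open>psnd\<close> and then taking \<open>pfst\<close> looks one of them up.\<close>

lemma computable_course:
  assumes "computable F"
  shows "computable (course F c)"
proof -
  let ?nth = "\<lambda>h k. pfst (rec_nat h (\<lambda>_. psnd) k)"
  let ?step = "\<lambda>n h. \<langle>F \<langle>n, \<langle>?nth h (n - pfst (psnd n)), ?nth h (n - psnd (psnd n))\<rangle>\<rangle>, h\<rangle>"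
  \<comment> \<open>the history of values up to \<open>n\<close>, latest first\<close>
  let ?hist = "rec_nat \<langle>c, 0\<rangle> ?step"
  \<comment> \<open>Moving one \<open>psnd\<close> to the inside turns a lookup at depth
    \<open>Suc k\<close> into one at depth \<open>k\<close> in the history one stage
    earlier.\<close>
  have shift: "rec_nat h (\<lambda>_. psnd) (Suc k) = rec_nat (psnd h) (\<lambda>_. psnd) k" for h k
    by (induction k) simp_all
  have nth: "?nth (?hist n) k = course F c (n - k)" if "k \<le> n" for n k
    using that
  proof (induction n arbitrary: k)
    case (Suc n)
    have le: "pfst (psnd n) \<le> n" "psnd (psnd n) \<le> n"
      by (meson order_trans pfst_le psnd_le)+
    show ?case
    proof (cases k)
      case 0
      then show ?thesis
        using Suc.IH[of "n - pfst (psnd n)"] Suc.IH[of "n - psnd (psnd n)"] le by simp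
    next
      case (Suc k')
      then show ?thesis
        using Suc.IH[of k'] Suc.prems by (simp only: shift) simp
    qed
  qed simp
  have nth_computable: "computable (\<lambda>x. ?nth (h x) (k x))" if "computable h" "computable k" for h k
    by (intro computable_intros computable_rec_nat that)
  have "computable ?hist"
    by (intro computable_rec_nat[where g = "\<lambda>_. ?step"] computable_intros
        computable_comp[OF assms] nth_computable)
  then have "computable (\<lambda>n. pfst (?hist n))"
    by (rule computable_pfst)
  moreover have "pfst (?hist n) = course F c n" for n
    using nth[of 0 n] by simp
  ultimately show ?thesis
    by (simp add: fun_eq_iff)
qed

section \<open>Enumeration of derivable numbers\<close>

text \<open>In \<open>P c w u v\<close> the number \<open>c\<close> is the conclusion and
  \<open>u\<close>, \<open>v\<close> are the premises. The witness \<open>w\<close> lets a decidable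
  \<open>P\<close> express unbounded existential side conditions. Rules with fewer premises can use
  the axiom as a filler.\<close>

inductive_set derivable :: "(nat \<Rightarrow> nat \<Rightarrow> nat \<Rightarrow> nat \<Rightarrow> bool) \<Rightarrow> nat \<Rightarrow> nat set"
  for P :: "nat \<Rightarrow> nat \<Rightarrow> nat \<Rightarrow> nat \<Rightarrow> bool" and a :: nat where
  axiom: "a \<in> derivable P a"
| rule: "u \<in> derivable P a \<Longrightarrow> v \<in> derivable P a \<Longrightarrow> P c w u v \<Longrightarrow> c \<in> derivable P a"

lemma derivable_enumeration:
  assumes "decidable (\<lambda>z. P (pfst (pfst z)) (psnd (pfst z)) (pfst (psnd z)) (psnd (psnd z)))"
  obtains G where "computable G" "derivable P a = range G"
proof
  \<comment> \<open>a derivation is coded by its conclusion, a witness and the codes of two subderivations;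
     codes with an invalid last step yield the axiom\<close>
  let ?F = "\<lambda>z. if P (pfst (pfst (pfst z))) (psnd (pfst (pfst z))) (pfst (psnd z)) (psnd (psnd z))
    then pfst (pfst (pfst z)) else a"
  \<comment> \<open>The argument of \<open>?F\<close> has the form \<langle>n, \<langle>u,
    v\<rangle>\<rangle> with n = \<langle>\<langle>c, w\<rangle>, \<langle>i, j\<rangle>\<rangle>,
    hence the extra \<open>pfst\<close> in front of \<open>c\<close> and \<open>w\<close>.\<close>
  have "decidable (\<lambda>z. P (pfst (pfst (pfst z))) (psnd (pfst (pfst z))) (pfst (psnd z)) (psnd (psnd z)))"
    using decidable_comp[OF assms, of "\<lambda>z. \<langle>pfst (pfst z), psnd z\<rangle>"]
    by (simp add: computable_intros)
  then show "computable (course ?F a)"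
    by (intro computable_course computable_intros)
  have "course ?F a n \<in> derivable P a" for n
    by (induction "?F" a n rule: course.induct) (auto intro: derivable.intros)
  moreover have "x \<in> range (course ?F a)" if "x \<in> derivable P a" for x
    using that
  proof induction
    case axiom
    show ?case
      by (rule range_eqI[of _ _ 0]) simp
  next
    case (rule u v c w)
    then obtain i j where "u = course ?F a i" "v = course ?F a j"
      by blast
    then show ?case
      \<comment> \<open>The code is shifted by \<open>Suc\<close> because 0 stands for the
        axiom.\<close>
      using rule.hyps by (intro range_eqI[of _ _ "Suc \<langle>\<langle>c, w\<rangle>, \<langle>i, j\<rangle>\<rangle>"]) simp
  qed
  ultimately show "derivable P a = range (course ?F a)"
    by blast
qed

section \<open>Evaluation of coded programs\<close>

text \<open>The code 7 is the loop of the unbounded search 8: it reports that all values below a bound are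
  defined and nonzero.\<close>

inductive eval_code :: "nat \<Rightarrow> nat \<Rightarrow> nat \<Rightarrow> bool" where
  zero: "eval_code \<langle>0, 0\<rangle> x 0"
| succ: "eval_code \<langle>1, 0\<rangle> x (Suc x)"
| proj1: "eval_code \<langle>2, 0\<rangle> x (pfst x)"
| proj2: "eval_code \<langle>3, 0\<rangle> x (psnd x)"
| pair: "eval_code a x u \<Longrightarrow> eval_code b x v \<Longrightarrow> eval_code \<langle>4, \<langle>a, b\<rangle>\<rangle> x \<langle>u, v\<rangle>"
| comp: "eval_code a x u \<Longrightarrow> eval_code b u v \<Longrightarrow> eval_code \<langle>5, \<langle>a, b\<rangle>\<rangle> x v"
| prim_0: "eval_code a x r \<Longrightarrow> eval_code \<langle>6, \<langle>a, b\<rangle>\<rangle> \<langle>x, 0\<rangle> r"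
| prim_Suc: "eval_code \<langle>6, \<langle>a, b\<rangle>\<rangle> \<langle>x, n\<rangle> r \<Longrightarrow> eval_code b \<langle>x, \<langle>n, r\<rangle>\<rangle> v \<Longrightarrow>
    eval_code \<langle>6, \<langle>a, b\<rangle>\<rangle> \<langle>x, Suc n\<rangle> v"
| loop_0: "eval_code \<langle>7, a\<rangle> \<langle>x, 0\<rangle> 0"
| loop_Suc: "eval_code \<langle>7, a\<rangle> \<langle>x, n\<rangle> 0 \<Longrightarrow> eval_code a \<langle>x, n\<rangle> (Suc k) \<Longrightarrow>
    eval_code \<langle>7, a\<rangle> \<langle>x, Suc n\<rangle> 0"
| min: "eval_code \<langle>7, a\<rangle> \<langle>x, n\<rangle> 0 \<Longrightarrow> eval_code a \<langle>x, n\<rangle> 0 \<Longrightarrow> eval_code \<langle>8, a\<rangle> x n"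

inductive_simps eval_zero_iff: "eval_code \<langle>0, 0\<rangle> x y"
  and eval_succ_iff: "eval_code \<langle>1, 0\<rangle> x y"
  and eval_proj1_iff: "eval_code \<langle>2, 0\<rangle> x y"
  and eval_proj2_iff: "eval_code \<langle>3, 0\<rangle> x y"
  and eval_pair_iff: "eval_code \<langle>4, \<langle>a, b\<rangle>\<rangle> x y"
  and eval_comp_iff: "eval_code \<langle>5, \<langle>a, b\<rangle>\<rangle> x y"
  and eval_prim_0_iff: "eval_code \<langle>6, \<langle>a, b\<rangle>\<rangle> \<langle>x, 0\<rangle> y"
  and eval_prim_Suc_iff: "eval_code \<langle>6, \<langle>a, b\<rangle>\<rangle> \<langle>x, Suc n\<rangle> y"
  and eval_loop_0_iff: "eval_code \<langle>7, a\<rangle> \<langle>x, 0\<rangle> y"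
  and eval_loop_Suc_iff: "eval_code \<langle>7, a\<rangle> \<langle>x, Suc n\<rangle> y"
  and eval_min_iff: "eval_code \<langle>8, a\<rangle> x y"

section \<open>Programs for the partial recursive functions\<close>

lemma eval_prim:
  assumes "\<And>x y. f x = Some y \<longleftrightarrow> eval_code a x y" "\<And>x y. g x = Some y \<longleftrightarrow> eval_code b x y"
  shows "primrec_at f g x n = Some y \<longleftrightarrow> eval_code \<langle>6, \<langle>a, b\<rangle>\<rangle> \<langle>x, n\<rangle> y"
  by (induction n arbitrary: y)
    (auto simp: assms eval_prim_0_iff eval_prim_Suc_iff bind_eq_Some_conv)

lemma eval_loop:
  "eval_code \<langle>7, a\<rangle> \<langle>x, n\<rangle> 0 \<longleftrightarrow> (\<forall>m<n. \<exists>k. eval_code a \<langle>x, m\<rangle> (Suc k))"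
  by (induction n) (auto simp: eval_loop_0_iff eval_loop_Suc_iff less_Suc_eq)

text \<open>The \<open>LEAST\<close> in \<open>minimize\<close> ignores definedness, but the least
  zero is at most the witness of the existential, below which all values are defined. The resulting
  form matches the codes 7 and 8.\<close>

lemma minimize_eq_Some_iff:
  "minimize f x = Some n \<longleftrightarrow> f \<langle>x, n\<rangle> = Some 0 \<and> (\<forall>m<n. \<exists>k. f \<langle>x, m\<rangle> = Some (Suc k))"
proof
  assume *: "minimize f x = Some n"
  then obtain i where i: "f \<langle>x, i\<rangle> = Some 0" "\<forall>m<i. f \<langle>x, m\<rangle> \<noteq> None"
    by (auto simp: minimize_def split: if_splits)
  with * have n: "n = (LEAST n. f \<langle>x, n\<rangle> = Some 0)"
    by (auto simp: minimize_def split: if_splits)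
  then have zero: "f \<langle>x, n\<rangle> = Some 0" and "n \<le> i"
    using i(1) by (auto intro: LeastI Least_le)
  have "\<exists>k. f \<langle>x, m\<rangle> = Some (Suc k)" if "m < n" for m
  proof -
    have "f \<langle>x, m\<rangle> \<noteq> Some 0"
      using that not_less_Least n by blast
    moreover have "f \<langle>x, m\<rangle> \<noteq> None"
      using i(2) that \<open>n \<le> i\<close> by auto
    ultimately show ?thesis
      by (metis not0_implies_Suc option.exhaust)
  qed
  with zero show "f \<langle>x, n\<rangle> = Some 0 \<and> (\<forall>m<n. \<exists>k. f \<langle>x, m\<rangle> = Some (Suc k))"
    by blast
next
  assume *: "f \<langle>x, n\<rangle> = Some 0 \<and> (\<forall>m<n. \<exists>k. f \<langle>x, m\<rangle> = Some (Suc k))"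
  then have "(LEAST n. f \<langle>x, n\<rangle> = Some 0) = n"
    by (intro Least_equality) (force simp: not_less[symmetric])+
  moreover from * have "\<exists>n. f \<langle>x, n\<rangle> = Some 0 \<and> (\<forall>m<n. f \<langle>x, m\<rangle> \<noteq> None)"
    by fastforce
  ultimately show "minimize f x = Some n"
    by (simp add: minimize_def)
qed

text \<open>Each constructor of \<open>partial_recursive\<close> has its own code, so an index is
  assembled by induction.\<close>

lemma partial_recursive_index:
  assumes "partial_recursive f"
  obtains e where "\<And>x y. f x = Some y \<longleftrightarrow> eval_code e x y"
proof -
  from assms have "\<exists>e. \<forall>x y. f x = Some y \<longleftrightarrow> eval_code e x y"
  proof induction
    case zero
    show ?case by (rule exI[of _ "\<langle>0, 0\<rangle>"]) (auto simp: eval_zero_iff)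
  next
    case succ
    show ?case by (rule exI[of _ "\<langle>1, 0\<rangle>"]) (auto simp: eval_succ_iff simp del: One_nat_def)
  next
    case proj1
    show ?case by (rule exI[of _ "\<langle>2, 0\<rangle>"]) (auto simp: eval_proj1_iff)
  next
    case proj2
    show ?case by (rule exI[of _ "\<langle>3, 0\<rangle>"]) (auto simp: eval_proj2_iff)
  next
    case (pair f g)
    then obtain a b where "\<forall>x y. f x = Some y \<longleftrightarrow> eval_code a x y"
      "\<forall>x y. g x = Some y \<longleftrightarrow> eval_code b x y"
      by blast
    then show ?case
      by (intro exI[of _ "\<langle>4, \<langle>a, b\<rangle>\<rangle>"]) (auto simp: eval_pair_iff bind_eq_Some_conv)
  next
    case (comp f g)
    then obtain a b where "\<forall>x y. f x = Some y \<longleftrightarrow> eval_code a x y"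
      "\<forall>x y. g x = Some y \<longleftrightarrow> eval_code b x y"
      by blast
    then show ?case
      by (intro exI[of _ "\<langle>5, \<langle>a, b\<rangle>\<rangle>"]) (auto simp: eval_comp_iff bind_eq_Some_conv)
  next
    case (prim f g)
    then obtain a b where "\<And>x y. f x = Some y \<longleftrightarrow> eval_code a x y"
      "\<And>x y. g x = Some y \<longleftrightarrow> eval_code b x y"
      by blast
    then show ?case
      by (intro exI[of _ "\<langle>6, \<langle>a, b\<rangle>\<rangle>"]) (simp add: eval_prim)
  next
    case (min f)
    then obtain a where "\<forall>x y. f x = Some y \<longleftrightarrow> eval_code a x y"
      by blast
    then show ?case
      by (intro exI[of _ "\<langle>8, a\<rangle>"]) (auto simp: minimize_eq_Some_iff eval_min_iff eval_loop)
  qed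
  then show thesis
    using that by blast
qed

text \<open>The parameters of each rule are read off the premises and the conclusion by projections instead of
  being quantified existentially, which makes the check decidable.\<close>

definition eval_step :: "nat \<Rightarrow> nat \<Rightarrow> nat \<Rightarrow> nat \<Rightarrow> nat \<Rightarrow> nat \<Rightarrow> nat \<Rightarrow> nat \<Rightarrow> nat \<Rightarrow> bool" where
  "eval_step e x y e1 x1 y1 e2 x2 y2 \<longleftrightarrow>
     e = \<langle>0, 0\<rangle> \<and> y = 0 \<or>
     e = \<langle>1, 0\<rangle> \<and> y = Suc x \<or>
     e = \<langle>2, 0\<rangle> \<and> y = pfst x \<or>
     e = \<langle>3, 0\<rangle> \<and> y = psnd x \<or>
     e = \<langle>4, \<langle>e1, e2\<rangle>\<rangle> \<and> x1 = x \<and> x2 = x \<and> y = \<langle>y1, y2\<rangle> \<or>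
     e = \<langle>5, \<langle>e1, e2\<rangle>\<rangle> \<and> x1 = x \<and> x2 = y1 \<and> y = y2 \<or>
     e = \<langle>6, \<langle>e1, psnd (psnd e)\<rangle>\<rangle> \<and> x = \<langle>x1, 0\<rangle> \<and> y = y1 \<or>
     e = \<langle>6, \<langle>pfst (psnd e), e2\<rangle>\<rangle> \<and> e1 = e \<and> x = \<langle>pfst x1, Suc (psnd x1)\<rangle> \<and>
       x2 = \<langle>pfst x1, \<langle>psnd x1, y1\<rangle>\<rangle> \<and> y = y2 \<or>
     e = \<langle>7, psnd e\<rangle> \<and> x = \<langle>pfst x, 0\<rangle> \<and> y = 0 \<or>
     e = \<langle>7, e2\<rangle> \<and> e1 = e \<and> x = \<langle>pfst x1, Suc (psnd x1)\<rangle> \<and> x2 = x1 \<and> y1 = 0 \<and> y2 \<noteq> 0 \<and> y = 0 \<or>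
     e = \<langle>8, e2\<rangle> \<and> e1 = \<langle>7, e2\<rangle> \<and> x1 = \<langle>x, y\<rangle> \<and> x2 = \<langle>x, y\<rangle> \<and> y1 = 0 \<and> y2 = 0"

text \<open>A judgement \<open>eval_code e x y\<close> is coded as \<langle>e, \<langle>x,
  y\<rangle>\<rangle>.\<close>

definition eval_rule :: "nat \<Rightarrow> nat \<Rightarrow> nat \<Rightarrow> nat \<Rightarrow> bool" where
  "eval_rule c w u v \<longleftrightarrow>
     eval_step (pfst c) (pfst (psnd c)) (psnd (psnd c)) (pfst u) (pfst (psnd u)) (psnd (psnd u))
       (pfst v) (pfst (psnd v)) (psnd (psnd v))"

lemma eval_step_sound:
  assumes "eval_step e x y e1 x1 y1 e2 x2 y2" "eval_code e1 x1 y1" "eval_code e2 x2 y2"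
  shows "eval_code e x y"
proof -
  \<comment> \<open>Surjectivity of pairing brings \<open>x1\<close> into the pair form that
    \<open>prim_Suc\<close> and \<open>loop_Suc\<close> require.\<close>
  have x1: "\<langle>pfst x1, psnd x1\<rangle> = x1"
    by simp
  show ?thesis
    using assms(1) unfolding eval_step_def
  proof (elim disjE conjE, goal_cases)
    case 1
    then show ?thesis by (metis eval_code.zero)
  next
    case 2
    then show ?thesis by (metis eval_code.succ)
  next
    case 3
    then show ?thesis by (metis eval_code.proj1)
  next
    case 4
    then show ?thesis by (metis eval_code.proj2)
  next
    case 5
    then show ?thesis using assms(2,3) by (metis eval_code.pair)
  next
    case 6
    then show ?thesis using assms(2,3) by (metis eval_code.comp)
  next
    case 7
    then show ?thesis using assms(2) by (metis eval_code.prim_0)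
  next
    case 8
    then show ?thesis using assms(2,3) x1 by (metis eval_code.prim_Suc)
  next
    case 9
    then show ?thesis by (metis eval_code.loop_0)
  next
    case 10
    then show ?thesis using assms(2,3) x1 by (metis eval_code.loop_Suc not0_implies_Suc)
  next
    case 11
    then show ?thesis using assms(2,3) by (metis eval_code.min)
  qed
qed

text \<open>The axiom is a true judgement, namely that the zero program maps 0 to 0. It therefore
  adds nothing false and can fill the empty premise slots.\<close>

lemma eval_code_iff_derivable:
  "eval_code e x y \<longleftrightarrow> \<langle>e, \<langle>x, y\<rangle>\<rangle> \<in> derivable eval_rule \<langle>\<langle>0, 0\<rangle>, \<langle>0, 0\<rangle>\<rangle>"
    (is "_ \<longleftrightarrow> _ \<in> ?D")
proof
  have rule: "\<langle>e, \<langle>x, y\<rangle>\<rangle> \<in> ?D"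
    if "\<langle>e1, \<langle>x1, y1\<rangle>\<rangle> \<in> ?D" "\<langle>e2, \<langle>x2, y2\<rangle>\<rangle> \<in> ?D" "eval_step e x y e1 x1 y1 e2 x2 y2"
    for e x y e1 x1 y1 e2 x2 y2
    by (rule derivable.rule[OF that(1,2), where w = 0]) (simp add: eval_rule_def that(3))
  note axiom = derivable.axiom[of "\<langle>\<langle>0, 0\<rangle>, \<langle>0, 0\<rangle>\<rangle>" eval_rule]
  show "eval_code e x y \<Longrightarrow> \<langle>e, \<langle>x, y\<rangle>\<rangle> \<in> ?D"
  proof (induction rule: eval_code.induct)
    case zero
    show ?case by (rule rule[OF axiom axiom]) (simp add: eval_step_def)
  next
    case succ
    show ?case by (rule rule[OF axiom axiom]) (simp add: eval_step_def)
  next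
    case proj1
    show ?case by (rule rule[OF axiom axiom]) (simp add: eval_step_def)
  next
    case proj2
    show ?case by (rule rule[OF axiom axiom]) (simp add: eval_step_def)
  next
    case pair
    show ?case by (rule rule[OF pair.IH]) (simp add: eval_step_def)
  next
    case comp
    show ?case by (rule rule[OF comp.IH]) (simp add: eval_step_def)
  next
    case prim_0
    show ?case by (rule rule[OF prim_0.IH axiom]) (simp add: eval_step_def)
  next
    case prim_Suc
    show ?case by (rule rule[OF prim_Suc.IH]) (simp add: eval_step_def)
  next
    case loop_0
    show ?case by (rule rule[OF axiom axiom]) (simp add: eval_step_def)
  next
    case loop_Suc
    show ?case by (rule rule[OF loop_Suc.IH]) (simp add: eval_step_def)
  next
    case min
    show ?case by (rule rule[OF min.IH]) (simp add: eval_step_def)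
  qed
  have "eval_code (pfst c) (pfst (psnd c)) (psnd (psnd c))" if "c \<in> ?D" for c
    using that
  proof induction
    case axiom
    show ?case by (simp add: eval_code.zero)
  next
    case rule
    then show ?case
      unfolding eval_rule_def by (blast intro: eval_step_sound)
  qed
  from this[of "\<langle>e, \<langle>x, y\<rangle>\<rangle>"] show "\<langle>e, \<langle>x, y\<rangle>\<rangle> \<in> ?D \<Longrightarrow> eval_code e x y"
    by simp
qed

lemma eval_enumeration:
  obtains G where "computable G" "\<And>e x y. eval_code e x y \<longleftrightarrow> \<langle>e, \<langle>x, y\<rangle>\<rangle> \<in> range G"
proof -
  have "decidable (\<lambda>z. eval_rule (pfst (pfst z)) (psnd (pfst z)) (pfst (psnd z)) (psnd (psnd z)))"
    unfolding eval_rule_def eval_step_def by (intro computable_intros)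
  then obtain G where "computable G" "derivable eval_rule \<langle>\<langle>0, 0\<rangle>, \<langle>0, 0\<rangle>\<rangle> = range G"
    by (rule derivable_enumeration)
  then show thesis
    using that eval_code_iff_derivable by simp
qed

section \<open>Computably enumerable sets\<close>

lemma ce_set_Collect_ex:
  assumes "decidable (\<lambda>z. P (pfst z) (psnd z))"
  shows "ce_set {x. \<exists>n. P x n}"
proof -
  \<comment> \<open>The predicate is negated because \<open>minimize\<close> searches for a zero;
    \<open>?f\<close> is total, so the search stops exactly when a witness exists.\<close>
  let ?f = "\<lambda>z. Some (of_bool (\<not> P (pfst z) (psnd z)) :: nat)"
  have "partial_recursive (minimize ?f)"
    using decidable_not[OF assms] by (auto simp: decidable_def computable_def intro: partial_recursive.min)
  moreover have "{x. \<exists>n. P x n} = dom (minimize ?f)"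
    by (auto simp: minimize_def split: if_splits)
  ultimately show ?thesis
    unfolding ce_set_def by blast
qed

lemma ce_set_range:
  assumes "computable G"
  shows "ce_set (range G)"
proof -
  have "decidable (\<lambda>z. pfst z = G (psnd z))"
    by (intro computable_intros computable_comp[OF assms])
  then show ?thesis
    using ce_set_Collect_ex[of "\<lambda>x n. x = G n"] by (simp add: full_SetCompr_eq)
qed

section \<open>A universal c.e. set and closure properties\<close>

text \<open>Dropping the output from the enumerated triples leaves the pairs of a program and an
  input on which it halts; the section at an index of \<open>f\<close> is the domain of
  \<open>f\<close>.\<close>

lemma universal_ce_set:
  obtains G where "computable G" "\<And>A. ce_set A \<Longrightarrow> \<exists>e. A = {x. \<langle>e, x\<rangle> \<in> range G}"
proof -
  obtain G where G: "computable G" "\<And>e x y. eval_code e x y \<longleftrightarrow> \<langle>e, \<langle>x, y\<rangle>\<rangle> \<in> range G"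
    by (rule eval_enumeration) blast
  let ?H = "\<lambda>n. \<langle>pfst (G n), pfst (psnd (G n))\<rangle>"
  have "computable ?H"
    by (intro computable_intros G(1))
  moreover have "\<exists>e. A = {x. \<langle>e, x\<rangle> \<in> range ?H}" if "ce_set A" for A
  proof -
    obtain f where f: "partial_recursive f" "A = dom f"
      using \<open>ce_set A\<close> unfolding ce_set_def by blast
    obtain e where e: "\<And>x y. f x = Some y \<longleftrightarrow> eval_code e x y"
      using f(1) by (rule partial_recursive_index) blast
    have "(\<exists>y. \<langle>e, \<langle>x, y\<rangle>\<rangle> = z) \<longleftrightarrow> \<langle>e, x\<rangle> = \<langle>pfst z, pfst (psnd z)\<rangle>" for x z
      by (metis pair_code_collapse prod_encode_inverse fst_conv snd_conv)
    then have "(\<exists>y. \<langle>e, \<langle>x, y\<rangle>\<rangle> \<in> range G) \<longleftrightarrow> \<langle>e, x\<rangle> \<in> range ?H" for x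
      unfolding image_iff by blast
    then have "A = {x. \<langle>e, x\<rangle> \<in> range ?H}"
      unfolding f(2) dom_def by (simp add: e G(2))
    then show ?thesis
      by (rule exI)
  qed
  ultimately show thesis
    by (rule that)
qed

text \<open>The witness \<open>n\<close> is a stage at which the universal enumeration outputs
  \<langle>e, x\<rangle>. With this converse of \<open>ce_set_Collect_ex\<close>, closure properties
  reduce to those of decidable predicates.\<close>

lemma ce_setE:
  assumes "ce_set A"
  obtains P where "decidable (\<lambda>z. P (pfst z) (psnd z))" "A = {x. \<exists>n. P x n}"
proof -
  obtain G e where G: "computable G" "A = {x. \<langle>e, x\<rangle> \<in> range G}"
    using universal_ce_set assms by metis
  show thesis
  proof (rule that)
    show "decidable (\<lambda>z. \<langle>e, pfst z\<rangle> = G (psnd z))"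
      by (intro computable_intros computable_comp[OF G(1)])
    show "A = {x. \<exists>n. \<langle>e, x\<rangle> = G n}"
      by (simp add: G(2) image_iff)
  qed
qed

lemma ce_set_decidable:
  assumes "decidable P"
  shows "ce_set {x. P x}"
  using ce_set_Collect_ex[of "\<lambda>x _. P x"] decidable_comp[OF assms computable_pfst[OF computable_id]]
  by simp

lemma ce_set_Un:
  assumes "ce_set A" "ce_set B"
  shows "ce_set (A \<union> B)"
proof -
  obtain P where P: "decidable (\<lambda>z. P (pfst z) (psnd z))" "A = {x. \<exists>n. P x n}"
    using assms(1) by (rule ce_setE)
  obtain Q where Q: "decidable (\<lambda>z. Q (pfst z) (psnd z))" "B = {x. \<exists>n. Q x n}"
    using assms(2) by (rule ce_setE)
  have "A \<union> B = {x. \<exists>n. P x n \<or> Q x n}"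
    using P(2) Q(2) by blast
  then show ?thesis
    using P(1) Q(1) by (simp add: ce_set_Collect_ex computable_intros)
qed

lemma ce_set_image:
  assumes "ce_set A" "computable f"
  shows "ce_set (f ` A)"
proof -
  obtain P where P: "decidable (\<lambda>z. P (pfst z) (psnd z))" "A = {x. \<exists>n. P x n}"
    using assms(1) by (rule ce_setE)
  \<comment> \<open>The number \<open>n\<close> packs a preimage together with its witness.\<close>
  have "f ` A = {y. \<exists>n. P (pfst n) (psnd n) \<and> y = f (pfst n)}"
    using P(2) by auto (metis fst_conv snd_conv prod_encode_inverse)
  moreover have "decidable (\<lambda>z. P (pfst (psnd z)) (psnd (psnd z)))"
    using decidable_comp[OF P(1), of psnd] by (simp add: computable_intros)
  moreover have "decidable (\<lambda>z. pfst z = f (pfst (psnd z)))"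
    by (intro computable_intros computable_comp[OF assms(2)])
  ultimately show ?thesis
    by (simp add: ce_set_Collect_ex decidable_conj)
qed

lemma prod_encode_image: "prod_encode ` W = {z. prod_decode z \<in> W}"
  by (auto simp: image_iff) (metis prod_decode_inverse)

section \<open>Ceers\<close>

text \<open>Equivalence relations on the whole type are closed under arbitrary
  intersections.\<close>

lemma equiv_hull:
  "equiv UNIV (equiv UNIV hull S)"
proof (rule hull_in)
  fix T :: "'a rel set"
  assume "Ball T (equiv UNIV)"
  then have T: "refl A" "sym A" "trans A" if "A \<in> T" for A
    using that by (auto elim: equivE)
  show "equiv UNIV (\<Inter>T)"
  proof (rule equivI)
    show "refl (\<Inter>T)"
      using T(1) by (auto simp: refl_on_def)
    show "sym (\<Inter>T)"
      using T(2) by (auto intro!: symI dest: symD)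
    show "trans (\<Inter>T)"
      using T(3) by (fastforce intro!: transI dest: transD)
  qed auto
qed

lemma equiv_hull_refl: "(x, x) \<in> equiv UNIV hull S"
  by (meson UNIV_I equivE equiv_hull refl_onD)

lemma equiv_hull_sym: "(x, y) \<in> equiv UNIV hull S \<Longrightarrow> (y, x) \<in> equiv UNIV hull S"
  by (meson equivE equiv_hull symD)

lemma equiv_hull_trans:
  "(x, y) \<in> equiv UNIV hull S \<Longrightarrow> (y, z) \<in> equiv UNIV hull S \<Longrightarrow> (x, z) \<in> equiv UNIV hull S"
  by (meson equivE equiv_hull transD)

lemma equiv_hull_minimal: "S \<subseteq> T \<Longrightarrow> equiv UNIV T \<Longrightarrow> equiv UNIV hull S \<subseteq> T"
  by (rule hull_minimal)

text \<open>Membership in \<open>S\<close> with its witness, reflexivity, symmetry and transitivity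
  are decidable rules with at most two premises. The axiom \<langle>0, 0\<rangle> is a reflexive
  pair and hence lies in the hull.\<close>

lemma ceer_hull:
  assumes "ce_rel S"
  shows "ceer (equiv UNIV hull S)" (is "ceer ?H")
proof -
  obtain P where P: "decidable (\<lambda>z. P (pfst z) (psnd z))" "prod_encode ` S = {x. \<exists>n. P x n}"
    using assms unfolding ce_rel_def by (rule ce_setE)
  define step where "step c w u v \<longleftrightarrow> P c w \<or> pfst c = psnd c \<or> c = \<langle>psnd u, pfst u\<rangle> \<or>
    psnd u = pfst v \<and> c = \<langle>pfst u, psnd v\<rangle>" for c w u v
  let ?D = "derivable step \<langle>0, 0\<rangle>"
  have "decidable (\<lambda>z. P (pfst (pfst z)) (psnd (pfst z)))"
    using decidable_comp[OF P(1), of pfst] by (simp add: computable_intros)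
  then have "decidable (\<lambda>z. step (pfst (pfst z)) (psnd (pfst z)) (pfst (psnd z)) (psnd (psnd z)))"
    unfolding step_def by (intro computable_intros)
  then have "ce_set ?D"
    using derivable_enumeration[of step] ce_set_range by metis
  moreover have "?D = prod_encode ` ?H"
  proof
    have P_hull: "prod_decode c \<in> ?H" if "P c w" for c w
      using that P(2) hull_subset[of S "equiv UNIV"] by (auto simp: prod_encode_image)
    have "prod_decode c \<in> ?H" if "c \<in> ?D" for c
      using that
    proof induction
      case axiom
      show ?case
        by (simp add: equiv_hull_refl)
    next
      case (rule u v c w)
      obtain c1 c2 where c: "c = \<langle>c1, c2\<rangle>"
        by (metis pair_code_collapse)
      obtain u1 u2 where u: "u = \<langle>u1, u2\<rangle>"
        by (metis pair_code_collapse)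
      obtain v1 v2 where v: "v = \<langle>v1, v2\<rangle>"
        by (metis pair_code_collapse)
      have "P c w \<or> c1 = c2 \<or> (c1, c2) = (u2, u1) \<or> u2 = v1 \<and> (c1, c2) = (u1, v2)"
        using rule.hyps(3) by (simp add: step_def c u v)
      moreover have "(u1, u2) \<in> ?H" "(v1, v2) \<in> ?H"
        using rule.IH unfolding u v prod_encode_inverse .
      ultimately show ?case
        using P_hull[of c w] unfolding c prod_encode_inverse
        by (metis equiv_hull_refl equiv_hull_sym equiv_hull_trans prod.inject)
    qed
    then show "?D \<subseteq> prod_encode ` ?H"
      by (auto simp: prod_encode_image)
    have sym_D: "\<langle>y, x\<rangle> \<in> ?D" if "\<langle>x, y\<rangle> \<in> ?D" for x y
      by (rule derivable.rule[OF that that, where w = 0]) (simp add: step_def)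
    have trans_D: "\<langle>x, z\<rangle> \<in> ?D" if "\<langle>x, y\<rangle> \<in> ?D" "\<langle>y, z\<rangle> \<in> ?D" for x y z
      by (rule derivable.rule[OF that, where w = 0]) (simp add: step_def)
    \<comment> \<open>The derivable pairs form an equivalence relation containing \<open>S\<close>,
      so minimality of the hull gives the remaining inclusion.\<close>
    have "equiv UNIV {(x, y). \<langle>x, y\<rangle> \<in> ?D}"
    proof (rule equivI)
      show "refl {(x, y). \<langle>x, y\<rangle> \<in> ?D}"
        by (auto simp: refl_on_def step_def intro!: derivable.rule[OF derivable.axiom derivable.axiom])
      show "sym {(x, y). \<langle>x, y\<rangle> \<in> ?D}"
        by (rule symI) (simp add: sym_D)
      show "trans {(x, y). \<langle>x, y\<rangle> \<in> ?D}"
        by (rule transI) (use trans_D in blast)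
    qed auto
    moreover have "S \<subseteq> {(x, y). \<langle>x, y\<rangle> \<in> ?D}"
    proof clarify
      fix x y
      assume "(x, y) \<in> S"
      then have "\<langle>x, y\<rangle> \<in> prod_encode ` S"
        by (rule imageI)
      then obtain w where "P \<langle>x, y\<rangle> w"
        unfolding P(2) by blast
      then show "\<langle>x, y\<rangle> \<in> ?D"
        by (intro derivable.rule[OF derivable.axiom derivable.axiom, where w = w]) (simp add: step_def)
    qed
    ultimately have "?H \<subseteq> {(x, y). \<langle>x, y\<rangle> \<in> ?D}"
      by (intro equiv_hull_minimal)
    then show "prod_encode ` ?H \<subseteq> ?D"
      by auto
  qed
  ultimately show ?thesis
    by (simp add: ceer_def ce_rel_def equiv_hull)
qed

lemma ceer_Id: "ceer Id"
proof -
  have "ce_set {z. pfst z = psnd z}"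
    by (intro ce_set_decidable computable_intros)
  moreover have "prod_encode ` Id = {z. pfst z = psnd z}"
    by (auto simp: prod_encode_image case_prod_beta Id_def prod_eq_iff)
  ultimately show ?thesis
    by (auto simp: ceer_def ce_rel_def equiv_def refl_on_def sym_def trans_def)
qed

text \<open>A ceer that relates distinct numbers; it will show that the universal ceer differs from
  \<open>Id\<close>.\<close>

lemma ceer_UNIV: "ceer UNIV"
proof -
  have "ce_set (UNIV :: nat set)"
    using ce_set_range[OF computable_id] by simp
  moreover have "prod_encode ` UNIV = UNIV"
    by (auto simp: prod_encode_image)
  ultimately show ?thesis
    by (auto simp: ceer_def ce_rel_def equiv_def refl_on_def sym_def trans_def)
qed

lemma reducible_trans:
  assumes "reducible A B" "reducible B C"
  shows "reducible A C"
proof -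
  obtain f where "computable f" "\<And>x y. (x, y) \<in> A \<longleftrightarrow> (f x, f y) \<in> B"
    using assms(1) unfolding reducible_def by blast
  moreover obtain g where "computable g" "\<And>x y. (x, y) \<in> B \<longleftrightarrow> (g x, g y) \<in> C"
    using assms(2) unfolding reducible_def by blast
  ultimately show ?thesis
    unfolding reducible_def by (intro exI[of _ "\<lambda>x. g (f x)"]) (simp add: computable_comp)
qed

section \<open>A universal ceer\<close>

text \<open>Column \<open>e\<close> of \<open>U\<close> is generated by the \<open>e\<close>-th c.e.
  set of pairs. If that set is a ceer, the column is a copy of it, and x \<mapsto> \<langle>e,
  x\<rangle> is the reduction.\<close>

lemma universal_ceer_exists:
  obtains U where "universal_ceer U" "U \<noteq> Id"
proof -
  obtain V where V: "ce_set V" "\<And>A. ce_set A \<Longrightarrow> \<exists>e. A = {x. \<langle>e, x\<rangle> \<in> V}"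
    using universal_ce_set ce_set_range by metis
  define S where "S = {(\<langle>e, x\<rangle>, \<langle>e, y\<rangle>) | e x y. \<langle>e, \<langle>x, y\<rangle>\<rangle> \<in> V}"
  let ?U = "equiv UNIV hull S"
  let ?h = "\<lambda>z. \<langle>\<langle>pfst z, pfst (psnd z)\<rangle>, \<langle>pfst z, psnd (psnd z)\<rangle>\<rangle>"
  have "prod_encode ` S = ?h ` V"
    unfolding S_def by (auto simp: image_iff prod_encode_image) (metis fst_conv snd_conv prod_encode_inverse pair_code_collapse)+
  moreover have "ce_set (?h ` V)"
    by (intro ce_set_image V(1) computable_intros)
  ultimately have "ceer ?U"
    by (intro ceer_hull) (simp add: ce_rel_def)
  have section_U: "\<exists>e. \<forall>x y. (x, y) \<in> E \<longleftrightarrow> (\<langle>e, x\<rangle>, \<langle>e, y\<rangle>) \<in> ?U" if "ceer E" for E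
  proof -
    obtain e where "prod_encode ` E = {x. \<langle>e, x\<rangle> \<in> V}"
      using V(2) \<open>ceer E\<close> unfolding ceer_def ce_rel_def by blast
    then have e: "(x, y) \<in> E \<longleftrightarrow> \<langle>e, \<langle>x, y\<rangle>\<rangle> \<in> V" for x y
      by (metis prod_encode_image mem_Collect_eq prod_encode_inverse)
    \<comment> \<open>An upper bound for the hull: it keeps columns apart, is \<open>E\<close> on
      column \<open>e\<close> and collapses every other column.\<close>
    let ?T = "{(a, b). pfst a = pfst b \<and> (pfst a = e \<longrightarrow> (psnd a, psnd b) \<in> E)}"
    have "equiv UNIV ?T"
      using \<open>ceer E\<close> unfolding ceer_def equiv_def refl_on_def
      by (auto intro!: symI transI dest: symD transD)
    moreover have "S \<subseteq> ?T"
      using e by (auto simp: S_def)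
    ultimately have "?U \<subseteq> ?T"
      by (intro equiv_hull_minimal)
    then have "(\<langle>e, x\<rangle>, \<langle>e, y\<rangle>) \<in> ?U \<Longrightarrow> (x, y) \<in> E" for x y
      by auto
    moreover have "(x, y) \<in> E \<Longrightarrow> (\<langle>e, x\<rangle>, \<langle>e, y\<rangle>) \<in> ?U" for x y
      using e hull_subset[of S "equiv UNIV"] unfolding S_def by blast
    ultimately show ?thesis
      by blast
  qed
  have "reducible E ?U" if "ceer E" for E
  proof -
    obtain e where "\<And>x y. (x, y) \<in> E \<longleftrightarrow> (\<langle>e, x\<rangle>, \<langle>e, y\<rangle>) \<in> ?U"
      using section_U[OF \<open>ceer E\<close>] by blast
    then show ?thesis
      unfolding reducible_def by (intro exI[of _ "\<lambda>x. \<langle>e, x\<rangle>"]) (simp add: computable_intros)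
  qed
  moreover have "?U \<noteq> Id"
  proof -
    \<comment> \<open>The column that copies \<open>UNIV\<close> relates two distinct codes.\<close>
    obtain e where "(\<langle>e, 0\<rangle>, \<langle>e, 1\<rangle>) \<in> ?U"
      using section_U[OF ceer_UNIV] by blast
    then show ?thesis
      by auto
  qed
  ultimately show thesis
    using that \<open>ceer ?U\<close> unfolding universal_ceer_def by blast
qed

section \<open>Copying a ceer into a quotient\<close>

lemma ce_rel_image:
  assumes "ce_rel U" "computable f"
  shows "ce_rel (map_prod f f ` U)"
proof -
  have "prod_encode ` map_prod f f ` U = (\<lambda>z. \<langle>f (pfst z), f (psnd z)\<rangle>) ` prod_encode ` U"
    by (force simp: image_image)
  moreover have "computable (\<lambda>z. \<langle>f (pfst z), f (psnd z)\<rangle>)"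
    by (intro computable_intros computable_comp[OF assms(2)])
  ultimately show ?thesis
    using assms(1) ce_set_image unfolding ce_rel_def by metis
qed

text \<open>The values of \<open>f\<close> lie in pairwise distinct \<open>E\<close>-classes, so
  these classes are merged only as \<open>U\<close> prescribes.\<close>

lemma quotient_along_transversal:
  fixes U :: "nat rel"
  assumes E: "equiv UNIV E" and U: "equiv UNIV U"
    and f: "\<And>x y. (f x, f y) \<in> E \<longleftrightarrow> x = y"
  shows "(f x, f y) \<in> quotient_by E (map_prod f f ` U) \<longleftrightarrow> (x, y) \<in> U"
proof
  \<comment> \<open>An upper bound for the quotient: related points are \<open>E\<close>-equivalent
    or lie in the classes of values of \<open>f\<close> at \<open>U\<close>-related
    arguments.\<close>
  let ?T = "E \<union> {(a, b). \<exists>x y. (a, f x) \<in> E \<and> (x, y) \<in> U \<and> (f y, b) \<in> E}"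
  have reflE: "(a, a) \<in> E" and reflU: "(a, a) \<in> U" for a
    using E U by (auto simp: equiv_def refl_on_def)
  have symE: "(a, b) \<in> E \<Longrightarrow> (b, a) \<in> E" and symU: "(a, b) \<in> U \<Longrightarrow> (b, a) \<in> U" for a b
    using E U by (auto simp: equiv_def dest: symD)
  have transE: "(a, b) \<in> E \<Longrightarrow> (b, c) \<in> E \<Longrightarrow> (a, c) \<in> E"
    and transU: "(a, b) \<in> U \<Longrightarrow> (b, c) \<in> U \<Longrightarrow> (a, c) \<in> U" for a b c
    using E U by (auto simp: equiv_def dest: transD)
  \<comment> \<open>A class contains at most one value of \<open>f\<close>; for transitivity this
    identifies the two arguments attached to the middle point.\<close>
  have inj: "x = y" if "(f x, a) \<in> E" "(a, f y) \<in> E" for x y a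
    using f transE that by blast
  have "equiv UNIV ?T"
  proof (rule equivI)
    show "refl ?T"
      using reflE by (auto simp: refl_on_def)
    show "sym ?T"
      by (rule symI) (use symE symU in blast)
    show "trans ?T"
      by (rule transI) (auto, (use transE transU inj in blast)+)
  qed auto
  moreover have "E \<union> map_prod f f ` U \<subseteq> ?T"
    using reflE by auto
  ultimately have "quotient_by E (map_prod f f ` U) \<subseteq> ?T"
    unfolding quotient_by_def by (intro equiv_hull_minimal)
  moreover assume "(f x, f y) \<in> quotient_by E (map_prod f f ` U)"
  ultimately have "(f x, f y) \<in> ?T"
    by (rule subsetD)
  \<comment> \<open>If the pair lies in \<open>E\<close>, then \<open>x = y\<close> and reflexivity
    of \<open>U\<close> applies; otherwise the arguments given by \<open>?T\<close> are
    \<open>x\<close> and \<open>y\<close> themselves.\<close>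
  then show "(x, y) \<in> U"
    by (auto simp: f reflU)
next
  assume "(x, y) \<in> U"
  then show "(f x, f y) \<in> quotient_by E (map_prod f f ` U)"
    using hull_subset[of "E \<union> map_prod f f ` U" "equiv UNIV"] unfolding quotient_by_def by auto
qed

section \<open>Lightness and universal quotients\<close>

theorem theorem4p8:
  fixes E :: "nat rel"
  assumes "ceer E"
  shows "light E \<longleftrightarrow> (\<exists>R. is_quotient_of R E \<and> R \<noteq> E \<and> universal_ceer R)"
proof
  assume "light E"
  then obtain f where f: "computable f" "\<And>x y. (f x, f y) \<in> E \<longleftrightarrow> x = y"
    unfolding light_def reducible_def by auto
  obtain U where U: "universal_ceer U" "U \<noteq> Id"
    by (rule universal_ceer_exists)
  then have "ceer U"
    by (simp add: universal_ceer_def)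
  let ?W = "map_prod f f ` U"
  let ?R = "quotient_by E ?W"
  have W: "ce_rel ?W"
    using \<open>ceer U\<close> f(1) by (auto simp: ceer_def intro: ce_rel_image)
  have R_U: "(f x, f y) \<in> ?R \<longleftrightarrow> (x, y) \<in> U" for x y
    using assms \<open>ceer U\<close> f(2) by (intro quotient_along_transversal) (auto simp: ceer_def)
  have "ce_rel (E \<union> ?W)"
    using assms W by (simp add: ceer_def ce_rel_def image_Un ce_set_Un)
  then have "ceer ?R"
    unfolding quotient_by_def by (rule ceer_hull)
  moreover have "reducible U ?R"
    using f(1) R_U unfolding reducible_def by blast
  ultimately have "universal_ceer ?R"
    using U(1) reducible_trans unfolding universal_ceer_def by blast
  moreover have "?R \<noteq> E"
  proof
    assume "?R = E"
    \<comment> \<open>Along \<open>f\<close> the quotient restricts to \<open>U\<close> and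
      \<open>E\<close> restricts to equality, so their coincidence would force
      \<open>U = Id\<close>.\<close>
    then have "(x, y) \<in> U \<longleftrightarrow> x = y" for x y
      using R_U[of x y] f(2)[of x y] by simp
    then show False
      using U(2) by auto
  qed
  ultimately show "\<exists>R. is_quotient_of R E \<and> R \<noteq> E \<and> universal_ceer R"
    using W unfolding is_quotient_of_def by blast
next
  assume "\<exists>R. is_quotient_of R E \<and> R \<noteq> E \<and> universal_ceer R"
  then obtain R W where R: "R = quotient_by E W" "universal_ceer R"
    unfolding is_quotient_of_def by blast
  then have "E \<subseteq> R"
    using hull_subset[of "E \<union> W" "equiv UNIV"] by (simp add: quotient_by_def)
  have "reducible Id R"
    using R(2) ceer_Id by (simp add: universal_ceer_def)
  then obtain f where f: "computable f" "\<And>x y. (x, y) \<in> Id \<longleftrightarrow> (f x, f y) \<in> R"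
    unfolding reducible_def by blast
  \<comment> \<open>Reflexivity of \<open>E\<close> gives one direction for the same
    \<open>f\<close>; the other holds because \<open>E\<close>-related values are
    \<open>R\<close>-related.\<close>
  have "(x, x) \<in> E" for x
    using assms by (auto simp: ceer_def equiv_def refl_on_def)
  then have "(x, y) \<in> Id \<longleftrightarrow> (f x, f y) \<in> E" for x y
    using \<open>E \<subseteq> R\<close> f(2)[of x y] by auto
  then show "light E"
    using assms f(1) unfolding light_def reducible_def by blast
qed

end
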